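(* Let $(\Sigma)$: $\dot g=\mathcal X(g)+\sum_{j=1}^m u_jB_j(g)$ be a linear system on the generalized Heisenberg group $\mathbb{H}^n$, let $D$ be the derivation associated to $\mathcal X$, let $Z$ be a generator of the center of $\mathfrak h^n$, and let $d\in\mathbb R$ be defined by $DZ=dZ$. It is assumed that $Z$ does not belong to the Lie subalgebra of $\mathfrak h^n$ generated by $B_1,\dots,B_m$ and that $d\neq 0$. Choose a symplectic basis $(X_1,Y_1,\dots,X_n,Y_n,Z)$ such that the $B_j$'s belong to the subspace of $\mathfrak h^n$ generated by the $X_i$'s and the $Y_i$'s, with associated coordinates $(x_1,y_1,\dots,x_n,y_n,z)$. If for some admissible change of variable $z\mapsto w$, the differential equation satisfied by $w$ being written $$\dot w=dw+l'(x_1,y_1,\dots,x_n,y_n)+Q'(x_1,y_1,\dots,x_n,y_n)$$ with $l'$ a linear form and $Q'$ a quadratic form in the $2n$ variables $x_1,y_1,\dots,x_n,y_n$, the quadratic form $Q'$ is non negative and $\ker(l')\subset\ker(Q')$, then $(\Sigma)$ is not controllable.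
   Context: $\mathbb{H}^n$ is the $(2n+1)$-dimensional simply connected Lie group of real $(n+2)\times(n+2)$ upper triangular matrices with ones on the diagonal, first row $(1,y_1,\dots,y_n,z)$, last column $(z,x_1,\dots,x_n,1)^T$, and all other off-diagonal entries $0$. Its Lie algebra $\mathfrak h^n$ (the right-invariant vector fields) has basis $X_i=\partial/\partial x_i$, $Y_i=\partial/\partial y_i+x_i\,\partial/\partial z$ $(1\le i\le n)$, $Z=\partial/\partial z$, with $[X_i,Y_i]=Z$ and all other brackets zero; its center is $\mathbb RZ$, equal to the derived algebra. A vector field $\mathcal X$ on a connected Lie group $G$ is linear if its flow is a one-parameter group of automorphisms of $G$; the associated derivation of the Lie algebra (of right-invariant vector fields) is $D=-\mathrm{ad}(\mathcal X)$. A linear system is a control system $\dot g=\mathcal X(g)+\sum_{j=1}^m u_jB_j(g)$ with $\mathcal X$ linear, the $B_j$ right-invariant, and inputs $u=(u_1,\dots,u_m)$ measurable, locally bounded, with values in $\mathbb R^m$. It is controllable if for all $g,h\in G$ some input steers $g$ to $h$ in some time $T\ge 0$. A basis $(X_1,Y_1,\dots,X_n,Y_n,Z)$ of $\mathfrak h^n$ (with $Z$ any generator of the center) is symplectic if $[X_i,Y_i]=Z$ for $i=1,\dots,n$ and all other brackets of basis elements vanish. To any symplectic basis is associated a coordinate system on $\mathbb H^n$ in which $X_i=\partial/\partial x_i$, $Y_i=\partial/\partial y_i+x_i\,\partial/\partial z$, $Z=\partial/\partial z$. In the coordinates associated with the chosen symplectic basis, the differential equation satisfied by $z$ along $(\Sigma)$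 does not depend on the controls and is $\dot z=dz+l(x_1,y_1,\dots,x_n,y_n)+Q(x_1,y_1,\dots,x_n,y_n)$, where $dz+l$ is the linear form that comes from the last line of the matrix of $D$ and $Q$ is a quadratic form in the $2n$ variables $x_1,y_1,\dots,x_n,y_n$. A change of variable $z\mapsto w$ is said to be admissible if it has the form $w=z+P(x_1,y_1,\dots,x_n,y_n)$, where $P$ is a polynomial of degree $2$ with no constant term. The differential equation satisfied by $w$ has again the form $\dot w=dw+l'+Q'$, where $l'$ is a linear form and $Q'$ is a quadratic form in $x_1,y_1,\dots,x_n,y_n$. The kernel of a quadratic form is the kernel of its associated symmetric bilinear form. *)

theory Defs
  imports
    "HOL-Analysis.Analysis"
    "HOL-Library.Function_Algebras"
    "HOL-Algebra.Group"
begin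

section \<open>Smooth maps\<close>

text \<open>Greatest fixed point: a map is smooth iff it is Frechet differentiable everywhere and all
  its directional derivatives are again smooth; between Euclidean spaces this is the class of
  infinitely differentiable maps.\<close>

coinductive smooth :: "('a::real_normed_vector \<Rightarrow> 'b::real_normed_vector) \<Rightarrow> bool" where
  smoothI: "\<lbrakk>\<And>p. (f has_derivative f' p) (at p); \<And>v. smooth (\<lambda>p. f' p v)\<rbrakk> \<Longrightarrow> smooth f"


section \<open>The generalized Heisenberg group\<close>

text \<open>The point \<open>(x, y, z)\<close> stands for the matrix with first row \<open>(1, y, z)\<close> and last column
  \<open>(z, x, 1)\<close>; \<open>heis_matrix_mult\<close> and \<open>inj_heis_matrix\<close> identify the two groups.
  The entries \<open>(x, y, z)\<close> form a global chart, so the tangent space at every point is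
  identified with the type itself, and a vector field is a map from the type to itself.
  The dimension parameter is \<open>CARD('n)\<close>.\<close>

type_synonym 'n heis = "(real^'n) \<times> (real^'n) \<times> real"

definition heis_matrix :: "'n::finite heis \<Rightarrow> real^(unit + 'n + unit)^(unit + 'n + unit)" where
  "heis_matrix = (\<lambda>(x, y, z). \<chi> r c.
     case (r, c) of
       (Inl _, Inl _) \<Rightarrow> 1
     | (Inl _, Inr (Inl j)) \<Rightarrow> y $ j
     | (Inl _, Inr (Inr _)) \<Rightarrow> z
     | (Inr (Inl i), Inr (Inl j)) \<Rightarrow> (if i = j then 1 else 0)
     | (Inr (Inl i), Inr (Inr _)) \<Rightarrow> x $ i
     | (Inr (Inr _), Inr (Inr _)) \<Rightarrow> 1
     | _ \<Rightarrow> 0)"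

definition heis_mult :: "'n::finite heis \<Rightarrow> 'n heis \<Rightarrow> 'n heis" where
  "heis_mult = (\<lambda>(x, y, z) (x', y', z'). (x + x', y + y', z + z' + y \<bullet> x'))"

lemma sum_three:
  "(\<Sum>k\<in>(UNIV::(unit + 'n::finite + unit) set). f k)
     = f (Inl ()) + (\<Sum>i\<in>UNIV. f (Inr (Inl i))) + f (Inr (Inr ()))" for f :: "_ \<Rightarrow> real"
  by (simp add: UNIV_Plus_UNIV[symmetric] sum.Plus UNIV_unit add.assoc)

lemma heis_matrix_mult: "heis_matrix (heis_mult g h) = heis_matrix g ** heis_matrix h"
  by (cases g; cases h)
     (auto simp: heis_matrix_def heis_mult_def matrix_matrix_mult_def vec_eq_iff sum_three
        inner_vec_def if_distrib if_distribR sum.delta sum.delta' cong: if_cong split: sum.splits)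

lemma inj_heis_matrix: "inj heis_matrix"
proof (rule injI)
  fix g h :: "'n::finite heis"
  assume eq: "heis_matrix g = heis_matrix h"
  obtain x y z x' y' z' where gh: "g = (x, y, z)" "h = (x', y', z')" by (cases g; cases h)
  have e: "heis_matrix g $ r $ c = heis_matrix h $ r $ c" for r c using eq by simp
  have "x = x'"
    using e[of "Inr (Inl i)" "Inr (Inr ())" for i] by (simp add: gh heis_matrix_def vec_eq_iff)
  moreover have "y = y'"
    using e[of "Inl ()" "Inr (Inl i)" for i] by (simp add: gh heis_matrix_def vec_eq_iff)
  moreover have "z = z'"
    using e[of "Inl ()" "Inr (Inr ())"] by (simp add: gh heis_matrix_def)
  ultimately show "g = h" by (simp add: gh)
qed

definition heis_group :: "('n::finite heis) monoid" where
  "heis_group = \<lparr>carrier = UNIV, monoid.mult = heis_mult, one = 0\<rparr>"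

lemma group_heis_group: "group heis_group"
proof (rule groupI)
  fix g :: "'n::finite heis"
  obtain x y z where "g = (x, y, z)" by (cases g)
  then have "heis_mult (- x, - y, y \<bullet> x - z) g = 0"
    by (simp add: heis_mult_def zero_prod_def)
  then show "\<exists>h\<in>carrier heis_group. h \<otimes>\<^bsub>heis_group\<^esub> g = \<one>\<^bsub>heis_group\<^esub>"
    by (auto simp: heis_group_def)
qed (auto simp: heis_group_def heis_mult_def zero_prod_def algebra_simps split: prod.splits)


section \<open>Vector fields and the Lie algebra\<close>

text \<open>Pointwise linear structure on vector fields; addition comes from
  \<open>HOL-Library.Function_Algebras\<close>.\<close>

instantiation "fun" :: (type, real_vector) real_vector
begin

definition scaleR_fun :: "real \<Rightarrow> ('a \<Rightarrow> 'b) \<Rightarrow> 'a \<Rightarrow> 'b" where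
  "scaleR_fun c f = (\<lambda>p. c *\<^sub>R f p)"

instance
  by standard (simp_all add: scaleR_fun_def fun_eq_iff algebra_simps)

end

text \<open>The sign convention is that of the commutator of derivations, for which
  \<open>[\<partial>/\<partial>x, \<partial>/\<partial>y + x \<partial>/\<partial>z] = \<partial>/\<partial>z\<close>.\<close>

definition lie_bracket ::
    "('a::real_normed_vector \<Rightarrow> 'a) \<Rightarrow> ('a \<Rightarrow> 'a) \<Rightarrow> 'a \<Rightarrow> 'a" where
  "lie_bracket V W =
     (\<lambda>p. frechet_derivative W (at p) (V p) - frechet_derivative V (at p) (W p))"

definition right_invariant :: "('n::finite heis \<Rightarrow> 'n heis) \<Rightarrow> bool" where
  "right_invariant V \<longleftrightarrow>
     (\<forall>g h. frechet_derivative (\<lambda>k. heis_mult k h) (at g) (V g) = V (heis_mult g h))"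

definition heis_algebra :: "('n::finite heis \<Rightarrow> 'n heis) set" where
  "heis_algebra = {V. smooth V \<and> right_invariant V}"

definition heis_center :: "('n::finite heis \<Rightarrow> 'n heis) set" where
  "heis_center = {V \<in> heis_algebra. \<forall>W\<in>heis_algebra. lie_bracket V W = 0}"

definition lie_subalgebra :: "('n::finite heis \<Rightarrow> 'n heis) set \<Rightarrow> bool" where
  "lie_subalgebra L \<longleftrightarrow>
     L \<subseteq> heis_algebra \<and> subspace L \<and> (\<forall>V\<in>L. \<forall>W\<in>L. lie_bracket V W \<in> L)"

abbreviation lie_generated ::
    "('n::finite heis \<Rightarrow> 'n heis) set \<Rightarrow> ('n heis \<Rightarrow> 'n heis) set" where
  "lie_generated S \<equiv> lie_subalgebra hull S"

text \<open>The basis is treated as a family, hence the injectivity condition.\<close>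

definition symplectic_basis ::
    "('n::finite \<Rightarrow> 'n heis \<Rightarrow> 'n heis) \<Rightarrow> ('n \<Rightarrow> 'n heis \<Rightarrow> 'n heis) \<Rightarrow> ('n heis \<Rightarrow> 'n heis) \<Rightarrow> bool"
  where
  "symplectic_basis X Y Z \<longleftrightarrow>
     (let b = case_sum X (case_sum Y (\<lambda>_::unit. Z))
      in inj b \<and> independent (range b) \<and> span (range b) = heis_algebra) \<and>
     span {Z} = heis_center \<and>
     (\<forall>i j. lie_bracket (X i) (Y j) = (if i = j then Z else 0)) \<and>
     (\<forall>i j. lie_bracket (X i) (X j) = 0) \<and>
     (\<forall>i j. lie_bracket (Y i) (Y j) = 0) \<and>
     (\<forall>i. lie_bracket (X i) Z = 0) \<and>
     (\<forall>i. lie_bracket (Y i) Z = 0)"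

definition std_X :: "'n::finite \<Rightarrow> 'n heis \<Rightarrow> 'n heis" where
  "std_X i = (\<lambda>(x, y, z). (axis i 1, 0, 0))"

definition std_Y :: "'n::finite \<Rightarrow> 'n heis \<Rightarrow> 'n heis" where
  "std_Y i = (\<lambda>(x, y, z). (0, axis i 1, x $ i))"

definition std_Z :: "'n::finite heis \<Rightarrow> 'n heis" where
  "std_Z = (\<lambda>(x, y, z). (0, 0, 1))"

text \<open>The differential equations alone determine \<open>\<Psi>\<close> up to a right translation; the
  identity element is taken as the origin of the coordinates.\<close>

definition associated_coordinates ::
    "('n::finite \<Rightarrow> 'n heis \<Rightarrow> 'n heis) \<Rightarrow> ('n \<Rightarrow> 'n heis \<Rightarrow> 'n heis) \<Rightarrow> ('n heis \<Rightarrow> 'n heis) \<Rightarrow>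
      ('n heis \<Rightarrow> (real^'n) \<times> (real^'n) \<times> real) \<Rightarrow> bool" where
  "associated_coordinates X Y Z \<Psi> \<longleftrightarrow>
     bij \<Psi> \<and> smooth \<Psi> \<and> smooth (inv_into UNIV \<Psi>) \<and> \<Psi> 0 = 0 \<and>
     (\<forall>g. (\<forall>i. frechet_derivative \<Psi> (at g) (X i g) = std_X i (\<Psi> g)) \<and>
          (\<forall>i. frechet_derivative \<Psi> (at g) (Y i g) = std_Y i (\<Psi> g)) \<and>
          frechet_derivative \<Psi> (at g) (Z g) = std_Z (\<Psi> g))"


section \<open>Linear vector fields and linear systems\<close>

definition linear_field :: "('n::finite heis \<Rightarrow> 'n heis) \<Rightarrow> bool" where
  "linear_field \<X> \<longleftrightarrow> smooth \<X> \<and>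
     (\<exists>\<phi> :: real \<Rightarrow> 'n heis \<Rightarrow> 'n heis.
        (\<forall>t. \<phi> t \<in> iso heis_group heis_group \<and> smooth (\<phi> t)) \<and>
        \<phi> 0 = id \<and> (\<forall>s t. \<phi> (s + t) = \<phi> s \<circ> \<phi> t) \<and>
        (\<forall>g t. ((\<lambda>t. \<phi> t g) has_vector_derivative \<X> (\<phi> t g)) (at t)))"

definition derivation_of :: "('n::finite heis \<Rightarrow> 'n heis) \<Rightarrow> ('n heis \<Rightarrow> 'n heis) \<Rightarrow> 'n heis \<Rightarrow> 'n heis"
  where
  "derivation_of \<X> V = - lie_bracket \<X> V"

definition system_field ::
    "('n::finite heis \<Rightarrow> 'n heis) \<Rightarrow> ('m::finite \<Rightarrow> 'n heis \<Rightarrow> 'n heis) \<Rightarrow> real^'m \<Rightarrow> 'n heis \<Rightarrow> 'n heis"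
  where
  "system_field \<X> B u g = \<X> g + (\<Sum>j\<in>UNIV. u $ j *\<^sub>R B j g)"

definition admissible_input :: "(real \<Rightarrow> real^'m::finite) \<Rightarrow> bool" where
  "admissible_input u \<longleftrightarrow> u \<in> borel_measurable lebesgue \<and> (\<forall>a b. bounded (u ` {a..b}))"

text \<open>Solutions in the sense of Caratheodory, i.e. of the associated integral equation.\<close>

definition trajectory ::
    "('n::finite heis \<Rightarrow> 'n heis) \<Rightarrow> ('m::finite \<Rightarrow> 'n heis \<Rightarrow> 'n heis) \<Rightarrow> (real \<Rightarrow> real^'m) \<Rightarrow>
      real \<Rightarrow> (real \<Rightarrow> 'n heis) \<Rightarrow> bool" where
  "trajectory \<X> B u T \<gamma> \<longleftrightarrow> continuous_on {0..T} \<gamma> \<and>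
     (\<forall>t\<in>{0..T}. ((\<lambda>s. system_field \<X> B (u s) (\<gamma> s)) has_integral (\<gamma> t - \<gamma> 0)) {0..t})"

definition controllable ::
    "('n::finite heis \<Rightarrow> 'n heis) \<Rightarrow> ('m::finite \<Rightarrow> 'n heis \<Rightarrow> 'n heis) \<Rightarrow> bool" where
  "controllable \<X> B \<longleftrightarrow>
     (\<forall>g h. \<exists>T\<ge>0. \<exists>u \<gamma>. admissible_input u \<and> trajectory \<X> B u T \<gamma> \<and> \<gamma> 0 = g \<and> \<gamma> T = h)"


section \<open>Quadratic forms and admissible changes of variable\<close>

definition quadratic_form :: "('a::real_vector \<Rightarrow> real) \<Rightarrow> bool" where
  "quadratic_form q \<longleftrightarrow> (\<exists>\<beta>. bilinear \<beta> \<and> (\<forall>v. q v = \<beta> v v))"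

definition polar_form :: "('a::real_vector \<Rightarrow> real) \<Rightarrow> 'a \<Rightarrow> 'a \<Rightarrow> real" where
  "polar_form q v w = (q (v + w) - q v - q w) / 2"

definition quadratic_kernel :: "('a::real_vector \<Rightarrow> real) \<Rightarrow> 'a set" where
  "quadratic_kernel q = {v. \<forall>w. polar_form q v w = 0}"

text \<open>Polynomials of degree at most 2 without constant term.\<close>

definition admissible_polynomial :: "('a::real_vector \<Rightarrow> real) \<Rightarrow> bool" where
  "admissible_polynomial P \<longleftrightarrow>
     (\<exists>l q. linear l \<and> quadratic_form q \<and> (\<forall>v. P v = l v + q v))"

definition xy_part ::
    "('n::finite heis \<Rightarrow> (real^'n) \<times> (real^'n) \<times> real) \<Rightarrow> 'n heis \<Rightarrow> (real^'n) \<times> (real^'n)" where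
  "xy_part \<Psi> g = (case \<Psi> g of (x, y, z) \<Rightarrow> (x, y))"

definition z_part :: "('n::finite heis \<Rightarrow> (real^'n) \<times> (real^'n) \<times> real) \<Rightarrow> 'n heis \<Rightarrow> real" where
  "z_part \<Psi> g = (case \<Psi> g of (x, y, z) \<Rightarrow> z)"

definition changed_variable ::
    "('n::finite heis \<Rightarrow> (real^'n) \<times> (real^'n) \<times> real) \<Rightarrow> ((real^'n) \<times> (real^'n) \<Rightarrow> real) \<Rightarrow>
      'n heis \<Rightarrow> real" where
  "changed_variable \<Psi> P g = z_part \<Psi> g + P (xy_part \<Psi> g)"

text \<open>\<open>w' = f\<close> along the system: the derivative of \<open>w\<close> in the direction of the right-hand side
  is \<open>f\<close>, for every value of the controls.\<close>

definition satisfies_equation ::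
    "('n::finite heis \<Rightarrow> 'n heis) \<Rightarrow> ('m::finite \<Rightarrow> 'n heis \<Rightarrow> 'n heis) \<Rightarrow>
      ('n heis \<Rightarrow> real) \<Rightarrow> ('n heis \<Rightarrow> real) \<Rightarrow> bool" where
  "satisfies_equation \<X> B w f \<longleftrightarrow>
     (\<forall>u g. frechet_derivative w (at g) (system_field \<X> B u g) = f g)"

end

theory Submission
  imports Defs
begin

text \<open>Write \<open>\<pi>\<close> for the \<open>(x, y)\<close>-part of the coordinates and \<open>w\<close> for the new variable,
  so that \<open>w' = d w + l'(\<pi>) + Q'(\<pi>)\<close> along every trajectory. A nonnegative form \<open>Q'\<close> whose
  kernel contains the hyperplane (or the whole space) \<open>ker l'\<close> is a multiple \<open>c l'\<^sup>2\<close> with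
  \<open>c \<ge> 0\<close> (\<open>quadratic_form_eq_square\<close>). The two cases \<open>c > 0\<close> and \<open>c = 0\<close> fail to be
  controllable for different reasons.

  If \<open>c > 0\<close>, completing the square gives \<open>l' + c l'\<^sup>2 \<ge> - 1 / (4 c)\<close>, hence
  \<open>w' \<ge> d (w - k)\<close> with \<open>k = 1 / (4 c d)\<close>. Then \<open>exp (- d t) (w - k)\<close> is nondecreasing along
  trajectories and the region \<open>w > k\<close> cannot be left (\<open>reachable_above\<close>).

  If \<open>c = 0\<close>, the equation \<open>w' = d w + l'(\<pi>)\<close> is linear. For a trajectory \<open>\<gamma>\<close> starting at the
  identity and a flow line \<open>\<eta>\<close> of \<open>\<X>\<close>, the product \<open>\<gamma> \<eta>\<close> is again a trajectory, with the same
  input: \<open>\<X>\<close> generates automorphisms and the controlled fields are right-invariant. Since \<open>\<pi>\<close>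
  is a homomorphism to a vector space (\<open>xy_part_mult\<close>), the defect
  \<open>\<delta> = w (\<gamma> \<eta>) - w \<gamma> - w \<eta>\<close> satisfies \<open>\<delta>' = d \<delta>\<close>, \<open>\<delta> 0 = 0\<close>, so it vanishes.
  The endpoint of \<open>\<eta>\<close> being arbitrary, \<open>w (h g) = w h + w g\<close> for all \<open>g\<close> and all \<open>h\<close>
  reachable from the identity (\<open>reachable_from_one_additive\<close>). If every \<open>h\<close> were reachable, \<open>w\<close>
  would be a homomorphism to \<open>\<real>\<close>, hence zero on commutators, that is on the center;
  but \<open>w\<close> equals \<open>1\<close> at the central element with coordinates \<open>(0, 0, 1)\<close>
  (\<open>coordinates_central\<close>).

  Inputs are only measurable, so trajectories need not be differentiable. The function \<open>w\<close>, however,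
  is differentiable along them, because its rate of change does not involve the input
  (\<open>caratheodory_chain_rule\<close>).\<close>

section \<open>Continuously differentiable maps\<close>

text \<open>The derivative is a bounded linear function depending continuously on the point in operator
  norm, which makes composition and evaluation continuous without further estimates.\<close>

definition C1 :: "('a::euclidean_space \<Rightarrow> 'b::euclidean_space) \<Rightarrow> bool" where
  "C1 f \<longleftrightarrow> (\<exists>f'. (\<forall>p. (f has_derivative blinfun_apply (f' p)) (at p)) \<and> continuous_on UNIV f')"

text \<open>In finite dimension, pointwise continuity of the derivative gives continuity in norm.\<close>

lemma C1I:
  fixes f :: "'a::euclidean_space \<Rightarrow> 'b::euclidean_space"
  assumes "\<And>p. (f has_derivative f' p) (at p)"
    and "\<And>v. continuous_on UNIV (\<lambda>p. f' p v)"
  shows "C1 f"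
proof -
  have apply_eq: "blinfun_apply (Blinfun (f' p)) = f' p" for p
    using assms(1)[of p] by (simp add: bounded_linear_Blinfun_apply has_derivative_bounded_linear)
  have "continuous_on UNIV (\<lambda>p. Blinfun (f' p))"
    by (rule continuous_on_blinfun_componentwise) (simp add: apply_eq assms(2))
  then show ?thesis
    unfolding C1_def using assms(1) by (intro exI[of _ "\<lambda>p. Blinfun (f' p)"]) (simp add: apply_eq)
qed

lemma C1_imp_continuous_on:
  assumes "C1 f"
  shows "continuous_on S f"
proof -
  obtain f' where "\<And>p. (f has_derivative blinfun_apply (f' p)) (at p)"
    using assms unfolding C1_def by metis
  then have "continuous_on UNIV f" by (rule has_derivative_continuous_on)
  then show ?thesis by (rule continuous_on_subset) simp
qed

lemma C1_compose:
  assumes "C1 f" "C1 g"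
  shows "C1 (\<lambda>p. g (f p))"
proof -
  obtain f' where f': "\<And>p. (f has_derivative blinfun_apply (f' p)) (at p)" "continuous_on UNIV f'"
    using assms(1) unfolding C1_def by metis
  obtain g' where g': "\<And>p. (g has_derivative blinfun_apply (g' p)) (at p)" "continuous_on UNIV g'"
    using assms(2) unfolding C1_def by metis
  have g'f: "continuous_on UNIV (\<lambda>p. g' (f p))"
    using continuous_on_compose2[OF g'(2) C1_imp_continuous_on[OF assms(1)]] by simp
  show ?thesis
  proof (rule C1I)
    show "((\<lambda>p. g (f p)) has_derivative (\<lambda>v. g' (f p) (f' p v))) (at p)" for p
      using has_derivative_compose[OF f'(1) g'(1)] .
    show "continuous_on UNIV (\<lambda>p. g' (f p) (f' p v))" for v
      by (intro continuous_intros g'f f'(2))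
  qed
qed

lemma C1_bounded_linear:
  assumes "bounded_linear f"
  shows "C1 f"
  by (rule C1I[where f' = "\<lambda>_. f"]) (auto intro: bounded_linear_imp_has_derivative assms)

lemma C1_add:
  assumes "C1 f" "C1 g"
  shows "C1 (\<lambda>p. f p + g p)"
proof -
  obtain f' where f': "\<And>p. (f has_derivative blinfun_apply (f' p)) (at p)" "continuous_on UNIV f'"
    using assms(1) unfolding C1_def by metis
  obtain g' where g': "\<And>p. (g has_derivative blinfun_apply (g' p)) (at p)" "continuous_on UNIV g'"
    using assms(2) unfolding C1_def by metis
  show ?thesis
    by (rule C1I[where f' = "\<lambda>p v. f' p v + g' p v"])
      (intro derivative_intros continuous_intros f' g')+
qed

lemma C1_diff:
  assumes "C1 f" "C1 g"
  shows "C1 (\<lambda>p. f p - g p)"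
  using C1_add[OF assms(1) C1_compose[OF assms(2) C1_bounded_linear[OF bounded_linear_minus[OF bounded_linear_ident]]]]
  by simp

lemma C1_bilinear:
  assumes "bounded_bilinear b" "C1 f" "C1 g"
  shows "C1 (\<lambda>p. b (f p) (g p))"
proof -
  interpret bounded_bilinear b by fact
  obtain f' where f': "\<And>p. (f has_derivative blinfun_apply (f' p)) (at p)" "continuous_on UNIV f'"
    using assms(2) unfolding C1_def by metis
  obtain g' where g': "\<And>p. (g has_derivative blinfun_apply (g' p)) (at p)" "continuous_on UNIV g'"
    using assms(3) unfolding C1_def by metis
  have "continuous_on UNIV f" "continuous_on UNIV g"
    using assms(2,3) by (simp_all add: C1_imp_continuous_on)
  then show ?thesis
    by (intro C1I[where f' = "\<lambda>p v. b (f p) (g' p v) + b (f' p v) (g p)"])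
      (intro FDERIV continuous_on continuous_intros f' g' | assumption)+
qed

lemma C1_Pair:
  assumes "C1 f" "C1 g"
  shows "C1 (\<lambda>p. (f p, g p))"
proof -
  obtain f' where f': "\<And>p. (f has_derivative blinfun_apply (f' p)) (at p)" "continuous_on UNIV f'"
    using assms(1) unfolding C1_def by metis
  obtain g' where g': "\<And>p. (g has_derivative blinfun_apply (g' p)) (at p)" "continuous_on UNIV g'"
    using assms(2) unfolding C1_def by metis
  show ?thesis
    by (rule C1I[where f' = "\<lambda>p v. (f' p v, g' p v)"])
      (intro derivative_intros continuous_intros f' g')+
qed

lemma smooth_continuous:
  assumes "smooth f"
  shows "continuous_on UNIV f"
  using assms by cases (auto intro: has_derivative_continuous_on)

lemma smooth_C1:
  fixes f :: "'a::euclidean_space \<Rightarrow> 'b::euclidean_space"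
  assumes "smooth f"
  shows "C1 f"
  using assms
proof cases
  case (smoothI f')
  then show ?thesis by (intro C1I[of f f'] smooth_continuous)
qed

text \<open>Constant maps form a class closed under directional derivatives, so coinduction applies.\<close>

lemma smooth_const: "smooth (\<lambda>p. c)"
proof -
  have "smooth f" if "\<exists>c. f = (\<lambda>_. c)" for f :: "'a::real_normed_vector \<Rightarrow> 'b::real_normed_vector"
    using that
  proof (coinduction arbitrary: f)
    case smooth
    then show ?case
      by (intro exI[of _ f] exI[of _ "\<lambda>_ _. 0"]) (auto intro!: derivative_eq_intros)
  qed
  then show ?thesis by blast
qed

lemma smooth_affine:
  assumes "bounded_linear A"
  shows "smooth (\<lambda>p. c + A p)"
proof (rule smoothI)
  show "((\<lambda>p. c + A p) has_derivative A) (at p)" for p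
    using has_derivative_add[OF has_derivative_const bounded_linear_imp_has_derivative[OF assms]]
    by simp
qed (rule smooth_const)

section \<open>Functions along Caratheodory trajectories\<close>

text \<open>The velocity \<open>F\<close> is merely bounded, but the component of it that \<open>W\<close> sees is the continuous
  function \<open>f\<close>. Comparing \<open>W\<close> with its derivative \<open>L\<close> at \<open>\<gamma> t\<close> splits \<open>W \<circ> \<gamma>\<close> in
  two: \<open>L \<circ> \<gamma>\<close> is the integral of a function continuous at \<open>t\<close> with value \<open>f t\<close>, and the remainder
  \<open>(W - L) \<circ> \<gamma>\<close> has derivative \<open>0\<close> at \<open>t\<close> because \<open>\<gamma>\<close> is Lipschitz.\<close>

lemma caratheodory_chain_rule:
  fixes \<gamma> F :: "real \<Rightarrow> 'a::euclidean_space" and W :: "'a \<Rightarrow> real"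
  assumes integral: "\<And>t. t \<in> {0..T} \<Longrightarrow> (F has_integral (\<gamma> t - \<gamma> 0)) {0..t}"
    and bounded: "bounded (F ` {0..T})"
    and \<gamma>_cont: "continuous_on {0..T} \<gamma>"
    and W': "\<And>p. (W has_derivative blinfun_apply (W' p)) (at p)" "continuous_on UNIV W'"
    and f: "continuous_on {0..T} f" "\<And>s. s \<in> {0..T} \<Longrightarrow> W' (\<gamma> s) (F s) = f s"
    and t: "t \<in> {0..T}"
  shows "((\<lambda>s. W (\<gamma> s)) has_real_derivative f t) (at t within {0..T})"
proof -
  obtain C where C: "C > 0" "\<And>s. s \<in> {0..T} \<Longrightarrow> norm (F s) \<le> C"
    using bounded by (auto simp: bounded_pos)
  have T: "0 \<le> T" using t by simp
  have F_int: "F integrable_on {0..T}"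
    using integral[of T] T by auto
  have \<gamma>_eq: "\<gamma> s = \<gamma> 0 + integral {0..s} F" if "s \<in> {0..T}" for s
    using integral[OF that] by (simp add: integral_unique)
  have lipschitz: "norm (\<gamma> b - \<gamma> a) \<le> C * \<bar>b - a\<bar>" if "a \<in> {0..T}" "b \<in> {0..T}" for a b
  proof -
    have *: "norm (\<gamma> b - \<gamma> a) \<le> C * (b - a)" if ab: "a \<in> {0..T}" "b \<in> {0..T}" "a \<le> b" for a b
    proof -
      have int0b: "F integrable_on {0..b}" using integral[OF ab(2)] by blast
      have "integral {0..a} F + integral {a..b} F = integral {0..b} F"
        using ab int0b by (intro Henstock_Kurzweil_Integration.integral_combine) auto
      then have "\<gamma> b - \<gamma> a = integral {a..b} F"
        using \<gamma>_eq[OF ab(1)] \<gamma>_eq[OF ab(2)] by (simp add: algebra_simps)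
      moreover have "norm (integral {a..b} F) \<le> C * (b - a)"
      proof -
        have "F integrable_on {a..b}"
          by (rule integrable_subinterval_real[OF F_int]) (use ab in auto)
        then have "(F has_integral integral {a..b} F) (cbox a b)" by (simp add: integrable_integral)
        from has_integral_bound[OF _ this, of C] show ?thesis
          using C ab by (auto simp: less_imp_le)
      qed
      ultimately show ?thesis by simp
    qed
    show ?thesis
      using *[of a b] *[of b a] that by (cases "a \<le> b") (auto simp: norm_minus_commute)
  qed
  define L where "L = W' (\<gamma> t)"
  \<comment> \<open>The integrand \<open>L (F s)\<close> differs from \<open>f s\<close> by a term that tends to zero as \<open>s\<close> tends to
    \<open>t\<close>; so it is continuous at \<open>t\<close>, which is enough for the fundamental theorem of calculus there.\<close>
  have L_int: "(\<lambda>s. L (F s)) integrable_on {0..T}"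
    using integrable_linear[OF F_int blinfun.bounded_linear_right[of L]] by (simp add: o_def)
  have "((\<lambda>s. f s + (L - W' (\<gamma> s)) (F s)) \<longlongrightarrow> f t + 0) (at t within {0..T})"
  proof (rule tendsto_add)
    show "(f \<longlongrightarrow> f t) (at t within {0..T})"
      using f(1) t by (simp add: continuous_on_def)
    have "((\<lambda>s. W' (\<gamma> s)) \<longlongrightarrow> L) (at t within {0..T})"
      using continuous_on_compose2[OF W'(2) \<gamma>_cont] t by (simp add: continuous_on_def L_def)
    then have "((\<lambda>s. norm (L - W' (\<gamma> s)) * C) \<longlongrightarrow> norm (L - L) * C) (at t within {0..T})"
      by (intro tendsto_intros)
    then have lim0: "((\<lambda>s. norm (L - W' (\<gamma> s)) * C) \<longlongrightarrow> 0) (at t within {0..T})" by simp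
    show "((\<lambda>s. (L - W' (\<gamma> s)) (F s)) \<longlongrightarrow> 0) (at t within {0..T})"
    proof (rule Lim_null_comparison[OF _ lim0])
      show "\<forall>\<^sub>F s in at t within {0..T}. norm ((L - W' (\<gamma> s)) (F s)) \<le> norm (L - W' (\<gamma> s)) * C"
        unfolding eventually_at_filter
        by (rule always_eventually) (meson C(2) mult_left_mono norm_blinfun norm_ge_zero order_trans)
    qed
  qed
  moreover have "f t = L (F t)" using f(2)[OF t] by (simp add: L_def)
  ultimately have "((\<lambda>s. f s + (L - W' (\<gamma> s)) (F s)) \<longlongrightarrow> L (F t)) (at t within {0..T})" by simp
  then have "((\<lambda>s. L (F s)) \<longlongrightarrow> L (F t)) (at t within {0..T})"
    by (rule Lim_transform_within[where d = 1])
      (auto simp: f(2)[symmetric] blinfun.diff_left)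
  then have "continuous (at t within {0..T}) (\<lambda>s. L (F s))" by (simp add: continuous_within)
  then have "((\<lambda>s. integral {0..s} (\<lambda>s. L (F s))) has_vector_derivative L (F t)) (at t within {0..T})"
    using integral_has_vector_derivative_continuous_at[OF L_int, of t "{}"] t by simp
  then have ftc: "((\<lambda>s. integral {0..s} (\<lambda>s. L (F s))) has_real_derivative f t) (at t within {0..T})"
    using \<open>f t = L (F t)\<close> by (simp add: has_real_derivative_iff_has_vector_derivative)
  have L\<gamma>: "L (\<gamma> s) = L (\<gamma> 0) + integral {0..s} (\<lambda>s. L (F s))" if "s \<in> {0..T}" for s
    using has_integral_linear[OF integral[OF that] blinfun.bounded_linear_right[of L]]
    by (simp add: o_def integral_unique blinfun.diff_right)
  have "((\<lambda>s. L (\<gamma> 0) + integral {0..s} (\<lambda>s. L (F s))) has_real_derivative f t) (at t within {0..T})"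
    using DERIV_add[OF DERIV_const ftc] by simp
  then have linear_part: "((\<lambda>s. L (\<gamma> s)) has_real_derivative f t) (at t within {0..T})"
    by (rule has_field_derivative_transform_within[OF _ zero_less_one t]) (rule L\<gamma>[symmetric])
  have remainder: "((\<lambda>s. W (\<gamma> s) - L (\<gamma> s)) has_derivative (\<lambda>_. 0)) (at t within {0..T})"
    unfolding has_derivative_within_alt
  proof (intro conjI allI impI)
    fix e :: real assume e: "e > 0"
    have "((\<lambda>p. W p - L p) has_derivative (\<lambda>v. L v - L v)) (at (\<gamma> t))"
      using has_derivative_diff[OF W'(1)[of "\<gamma> t"] bounded_linear_imp_has_derivative[OF blinfun.bounded_linear_right[of L]]]
      by (simp add: L_def)
    then have "((\<lambda>p. W p - L p) has_derivative (\<lambda>v. 0)) (at (\<gamma> t) within UNIV)" by simp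
    then obtain \<delta> where \<delta>: "\<delta> > 0" "\<And>p. norm (p - \<gamma> t) < \<delta> \<Longrightarrow>
        norm (W p - L p - (W (\<gamma> t) - L (\<gamma> t))) \<le> e / C * norm (p - \<gamma> t)"
      unfolding has_derivative_within_alt using e C(1) by (auto dest!: spec[of _ "e / C"])
    show "\<exists>\<delta>>0. \<forall>s\<in>{0..T}. norm (s - t) < \<delta> \<longrightarrow>
        norm (W (\<gamma> s) - L (\<gamma> s) - (W (\<gamma> t) - L (\<gamma> t)) - 0) \<le> e * norm (s - t)"
    proof (intro exI[of _ "\<delta> / C"] conjI ballI impI)
      fix s assume s: "s \<in> {0..T}" "norm (s - t) < \<delta> / C"
      have lip: "norm (\<gamma> s - \<gamma> t) \<le> C * \<bar>s - t\<bar>" using lipschitz[OF t s(1)] .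
      also have "\<dots> < \<delta>" using s(2) C(1) by (simp add: field_simps)
      finally have "norm (W (\<gamma> s) - L (\<gamma> s) - (W (\<gamma> t) - L (\<gamma> t))) \<le> e / C * norm (\<gamma> s - \<gamma> t)"
        by (rule \<delta>(2))
      also have "\<dots> \<le> e / C * (C * \<bar>s - t\<bar>)"
        using lip e C(1) by (intro mult_left_mono) auto
      finally show "norm (W (\<gamma> s) - L (\<gamma> s) - (W (\<gamma> t) - L (\<gamma> t)) - 0) \<le> e * norm (s - t)"
        using C(1) by simp
    qed (use \<delta>(1) C(1) in auto)
  qed simp
  have "((\<lambda>s. W (\<gamma> s) - L (\<gamma> s)) has_real_derivative 0) (at t within {0..T})"
    using remainder by (simp add: has_field_derivative_def lambda_zero)
  from DERIV_add[OF this linear_part] show ?thesis by simp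
qed

text \<open>Gronwall's inequality, from the mean value theorem for \<open>exp (- d t) f t\<close>, whose derivative is nonnegative.\<close>

lemma differential_inequality:
  fixes f :: "real \<Rightarrow> real"
  assumes "\<And>t. t \<in> {0..T} \<Longrightarrow> (f has_real_derivative f' t) (at t within {0..T})"
    and "\<And>t. t \<in> {0..T} \<Longrightarrow> f' t \<ge> d * f t"
    and "0 \<le> T"
  shows "f T \<ge> exp (d * T) * f 0"
proof (cases "T = 0")
  case False
  then have T: "0 < T" using assms(3) by simp
  have "\<exists>t\<in>{0<..<T}. exp (- d * T) * f T - exp (- d * 0) * f 0
      = (\<lambda>h. (exp (- d * t) * (f' t - d * f t)) * h) (T - 0)"
  proof (rule mvt_simple[OF T])
    fix t assume "0 \<le> t" "t \<le> T"
    then show "((\<lambda>t. exp (- d * t) * f t) has_derivative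
        (\<lambda>h. (exp (- d * t) * (f' t - d * f t)) * h)) (at t within {0..T})"
      using assms(1)[of t] unfolding has_field_derivative_def[symmetric]
      by (auto intro!: derivative_eq_intros simp: algebra_simps)
  qed
  then obtain t where t: "t \<in> {0<..<T}"
    "exp (- d * T) * f T - f 0 = exp (- d * t) * (f' t - d * f t) * T" by auto
  have "exp (- d * T) * f T - f 0 \<ge> 0"
    unfolding t(2) using assms(2)[of t] t(1) T by (intro mult_nonneg_nonneg) auto
  then have "exp (d * T) * (exp (- d * T) * f T) \<ge> exp (d * T) * f 0"
    by (intro mult_left_mono) auto
  then show ?thesis by (simp add: mult.assoc[symmetric] exp_add[symmetric])
qed simp

section \<open>Quadratic forms that vanish with a linear form\<close>

text \<open>The form \<open>q\<close> descends to the quotient by \<open>ker l\<close>, which has dimension at most one. For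
  \<open>v\<^sub>0\<close> with \<open>l v\<^sub>0 = 1\<close>, the vector \<open>v\<close> differs from \<open>l v *\<^sub>R v\<^sub>0\<close> by an element of the kernel of
  \<open>q\<close>, so \<open>c = q v\<^sub>0\<close>.\<close>

lemma quadratic_form_eq_square:
  assumes l: "linear l" and q: "quadratic_form q" and nonneg: "\<And>v. q v \<ge> 0"
    and ker: "{v. l v = 0} \<subseteq> quadratic_kernel q"
  shows "\<exists>c\<ge>0. \<forall>v. q v = c * (l v)\<^sup>2"
proof -
  obtain \<beta> where \<beta>: "bilinear \<beta>" "\<And>v. q v = \<beta> v v"
    using q unfolding quadratic_form_def by blast
  have q_scale: "q (r *\<^sub>R v) = r\<^sup>2 * q v" for r v
    by (simp add: \<beta> bilinear_lmul[OF \<beta>(1)] bilinear_rmul[OF \<beta>(1)] power2_eq_square)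
  have polar_self: "polar_form q v v = q v" for v
    using q_scale[of 2 v] by (simp add: polar_form_def scaleR_2)
  have q0: "q v = 0" if "l v = 0" for v
    using ker that polar_self[of v] by (auto simp: quadratic_kernel_def)
  show ?thesis
  proof (cases "\<exists>v. l v \<noteq> 0")
    case False
    then show ?thesis using q0 by (intro exI[of _ 0]) auto
  next
    case True
    then obtain v\<^sub>1 where v\<^sub>1: "l v\<^sub>1 \<noteq> 0" by blast
    define v\<^sub>0 where "v\<^sub>0 = (1 / l v\<^sub>1) *\<^sub>R v\<^sub>1"
    have v\<^sub>0: "l v\<^sub>0 = 1" using v\<^sub>1 by (simp add: v\<^sub>0_def linear_scale[OF l])
    have "q v = q v\<^sub>0 * (l v)\<^sup>2" for v
    proof -
      define k where "k = v - l v *\<^sub>R v\<^sub>0"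
      have "l k = 0" by (simp add: k_def linear_diff[OF l] linear_scale[OF l] v\<^sub>0)
      then have "polar_form q k (l v *\<^sub>R v\<^sub>0) = 0" "q k = 0"
        using ker q0 by (auto simp: quadratic_kernel_def)
      moreover have "k + l v *\<^sub>R v\<^sub>0 = v" by (simp add: k_def)
      ultimately show ?thesis by (simp add: polar_form_def q_scale)
    qed
    then show ?thesis using nonneg by blast
  qed
qed

section \<open>Right-invariant fields and linear systems on the Heisenberg group\<close>

lemma heis_mult_eq:
  "heis_mult p q = (fst p + fst q, fst (snd p) + fst (snd q),
     snd (snd p) + snd (snd q) + fst (snd p) \<bullet> fst q)"
  by (simp add: heis_mult_def split: prod.splits)

lemma C1_heis_mult: "C1 (\<lambda>k::'n::finite heis \<times> 'n heis. heis_mult (fst k) (snd k))"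
  unfolding heis_mult_eq
  by (intro C1_Pair C1_add C1_bilinear[OF bounded_bilinear_inner] C1_bounded_linear bounded_linear_intros)

lemma heis_mult_zero [simp]: "heis_mult 0 g = g" "heis_mult g 0 = g"
  by (simp_all add: heis_mult_eq)

lemma has_derivative_right_translation:
  "((\<lambda>k. heis_mult k h) has_derivative
     (\<lambda>v. (fst v, fst (snd v), snd (snd v) + fst (snd v) \<bullet> fst h))) (at g)"
  unfolding heis_mult_eq by (auto intro!: derivative_eq_intros)

lemma right_invariant_iff:
  "right_invariant V \<longleftrightarrow>
     (\<forall>g h. V (heis_mult g h)
       = (fst (V g), fst (snd (V g)), snd (snd (V g)) + fst (snd (V g)) \<bullet> fst h))"
  unfolding right_invariant_def frechet_derivative_at[OF has_derivative_right_translation, symmetric]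
  by (simp add: eq_commute)

lemma right_invariant_eq:
  assumes "right_invariant V"
  shows "V p = (fst (V 0), fst (snd (V 0)), snd (snd (V 0)) + fst (snd (V 0)) \<bullet> fst p)"
  using assms[unfolded right_invariant_iff, rule_format, of 0 p] by simp

text \<open>The right-invariant fields span every tangent space: a derivative that kills them all is zero.\<close>

lemma heis_algebra_value:
  obtains V where "V \<in> heis_algebra" "V g = e"
proof -
  define A :: "'a heis \<Rightarrow> 'a heis" where "A = (\<lambda>p. (0, 0, fst (snd e) \<bullet> fst p))"
  define V where "V = (\<lambda>p. (e - A g) + A p)"
  have "bounded_linear A" unfolding A_def
    by (intro bounded_linear_intros)
  then have "smooth V" unfolding V_def by (rule smooth_affine)
  moreover have "right_invariant V"
    unfolding right_invariant_iff by (simp add: V_def A_def heis_mult_eq prod_eq_iff inner_add_right)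
  ultimately show ?thesis using that[of V] by (simp add: heis_algebra_def V_def)
qed

text \<open>By \<open>right_invariant_eq\<close>, the derivative of a right-invariant field only has a \<open>z\<close>-component.\<close>

lemma lie_bracket_heis_algebra_vertical:
  assumes "V \<in> heis_algebra" "W \<in> heis_algebra"
  shows "fst (lie_bracket V W p) = 0" "fst (snd (lie_bracket V W p)) = 0"
proof -
  have deriv: "frechet_derivative U (at p) = (\<lambda>v. (0, 0, fst (snd (U 0)) \<bullet> fst v))"
    if "U \<in> heis_algebra" for U :: "'a heis \<Rightarrow> 'a heis" and p
  proof -
    have "U = (\<lambda>p. (fst (U 0), fst (snd (U 0)), snd (snd (U 0)) + fst (snd (U 0)) \<bullet> fst p))"
      using right_invariant_eq that by (auto simp: heis_algebra_def fun_eq_iff)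
    moreover have "(\<dots> has_derivative (\<lambda>v. (0, 0, fst (snd (U 0)) \<bullet> fst v))) (at p)"
      by (auto intro!: derivative_eq_intros)
    ultimately show ?thesis using frechet_derivative_at by metis
  qed
  show "fst (lie_bracket V W p) = 0" "fst (snd (lie_bracket V W p)) = 0"
    by (simp_all add: lie_bracket_def deriv assms)
qed

lemma system_field_zero [simp]: "system_field \<X> B 0 g = \<X> g"
  by (simp add: system_field_def)

lemma trajectory_field_bounded:
  fixes \<X> :: "'n::finite heis \<Rightarrow> 'n heis" and B :: "'m::finite \<Rightarrow> 'n heis \<Rightarrow> 'n heis"
  assumes "continuous_on UNIV \<X>" "\<And>j. continuous_on UNIV (B j)"
    and "admissible_input u" "continuous_on {0..T} \<gamma>"
  shows "bounded ((\<lambda>s. system_field \<X> B (u s) (\<gamma> s)) ` {0..T})"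
proof -
  have along: "\<exists>K. \<forall>s\<in>{0..T}. norm (V (\<gamma> s)) \<le> K" if "continuous_on UNIV V" for V :: "'n heis \<Rightarrow> 'n heis"
  proof -
    have "bounded ((\<lambda>s. V (\<gamma> s)) ` {0..T})"
      using continuous_on_compose2[OF that assms(4)]
      by (intro compact_imp_bounded compact_continuous_image) auto
    then show ?thesis by (auto simp: bounded_iff)
  qed
  obtain K\<^sub>0 where K\<^sub>0: "\<And>s. s \<in> {0..T} \<Longrightarrow> norm (\<X> (\<gamma> s)) \<le> K\<^sub>0"
    using along[OF assms(1)] by blast
  have "\<forall>j. \<exists>K. \<forall>s\<in>{0..T}. norm (B j (\<gamma> s)) \<le> K" using along[OF assms(2)] by blast
  then obtain K where K: "\<And>j s. s \<in> {0..T} \<Longrightarrow> norm (B j (\<gamma> s)) \<le> K j" by metis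
  obtain U where U: "\<And>s. s \<in> {0..T} \<Longrightarrow> norm (u s) \<le> U"
    using assms(3) unfolding admissible_input_def bounded_iff by blast
  have "norm (system_field \<X> B (u s) (\<gamma> s)) \<le> K\<^sub>0 + (\<Sum>j\<in>UNIV. U * K j)" if s: "s \<in> {0..T}" for s
  proof -
    have "norm (u s $ j *\<^sub>R B j (\<gamma> s)) \<le> U * K j" for j
      using K[OF s, of j] order_trans[OF component_le_norm_cart U[OF s]]
      by (simp add: mult_mono order_trans[OF norm_ge_zero U[OF s]])
    then have "norm (\<Sum>j\<in>UNIV. u s $ j *\<^sub>R B j (\<gamma> s)) \<le> (\<Sum>j\<in>UNIV. U * K j)"
      by (intro sum_norm_le)
    then show ?thesis
      unfolding system_field_def by (intro norm_triangle_le add_mono K\<^sub>0 s)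
  qed
  then show ?thesis by (intro boundedI[where B = "K\<^sub>0 + (\<Sum>j\<in>UNIV. U * K j)"]) auto
qed

text \<open>In the next three lemmas \<open>M'\<close> is the derivative of the multiplication at \<open>(p, q)\<close>; they compute
  the velocity of a product of two curves from the velocities of its factors.\<close>

lemma heis_mult_deriv_right_invariant:
  assumes M': "((\<lambda>k. heis_mult (fst k) (snd k)) has_derivative M') (at (p, q))"
    and "right_invariant V"
  shows "M' (V p, 0) = V (heis_mult p q)"
proof -
  have "((\<lambda>k. (k, q)) has_derivative (\<lambda>v. (v, 0))) (at p)"
    by (auto intro!: derivative_eq_intros)
  from has_derivative_compose[OF this, of "\<lambda>k. heis_mult (fst k) (snd k)" M'] M'
  have "((\<lambda>k. heis_mult k q) has_derivative (\<lambda>v. M' (v, 0))) (at p)" by simp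
  then show ?thesis
    using assms(2) frechet_derivative_at unfolding right_invariant_def by metis
qed

text \<open>The identity \<open>\<phi> t (p q) = \<phi> t p \<cdot> \<phi> t q\<close> for the flow of \<open>\<X>\<close>, differentiated at \<open>t = 0\<close>.\<close>

lemma heis_mult_deriv_linear_field:
  assumes "linear_field \<X>"
    and M': "((\<lambda>k. heis_mult (fst k) (snd k)) has_derivative M') (at (p, q))"
  shows "M' (\<X> p, \<X> q) = \<X> (heis_mult p q)"
proof -
  obtain \<phi> where \<phi>: "\<And>t. \<phi> t \<in> iso heis_group heis_group" "\<phi> 0 = id"
    "\<And>g t. ((\<lambda>t. \<phi> t g) has_vector_derivative \<X> (\<phi> t g)) (at t)"
    using assms(1) unfolding linear_field_def by blast
  have mult: "\<phi> t (heis_mult g h) = heis_mult (\<phi> t g) (\<phi> t h)" for t g h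
    using hom_mult[of "\<phi> t" heis_group heis_group g h] \<phi>(1)[of t] by (simp add: iso_def heis_group_def)
  have flow: "((\<lambda>t. \<phi> t g) has_derivative (\<lambda>t. t *\<^sub>R \<X> g)) (at 0)" for g
    using \<phi>(3)[of g 0] by (simp add: \<phi>(2) has_vector_derivative_def)
  have pair: "((\<lambda>t. (\<phi> t p, \<phi> t q)) has_derivative (\<lambda>t. (t *\<^sub>R \<X> p, t *\<^sub>R \<X> q))) (at 0)"
    by (intro derivative_intros flow)
  have "((\<lambda>t. heis_mult (\<phi> t p) (\<phi> t q)) has_derivative (\<lambda>t. M' (t *\<^sub>R \<X> p, t *\<^sub>R \<X> q))) (at 0)"
    using has_derivative_compose[OF pair, of "\<lambda>k. heis_mult (fst k) (snd k)" M'] M' by (simp add: \<phi>(2))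
  then have "((\<lambda>t. \<phi> t (heis_mult p q)) has_derivative (\<lambda>t. M' (t *\<^sub>R \<X> p, t *\<^sub>R \<X> q))) (at 0)"
    by (simp add: mult)
  from fun_cong[OF has_derivative_unique[OF this flow], of 1] show ?thesis by simp
qed

text \<open>A trajectory multiplied on the right by a flow line of \<open>\<X>\<close> (input \<open>0\<close>) follows the system with
  the input of the trajectory.\<close>

lemma heis_mult_deriv_system_field:
  assumes "linear_field \<X>" "\<And>j. right_invariant (B j)"
    and M': "((\<lambda>k. heis_mult (fst k) (snd k)) has_derivative M') (at (p, q))"
  shows "M' (system_field \<X> B u p, \<X> q) = system_field \<X> B u (heis_mult p q)"
proof -
  have lin: "linear M'" using M' by (rule has_derivative_linear)
  have "(system_field \<X> B u p, \<X> q) = (\<X> p, \<X> q) + (\<Sum>j\<in>UNIV. u $ j *\<^sub>R (B j p, 0))"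
    by (simp add: system_field_def prod_eq_iff fst_sum snd_sum)
  then have "M' (system_field \<X> B u p, \<X> q)
      = M' (\<X> p, \<X> q) + (\<Sum>j\<in>UNIV. u $ j *\<^sub>R M' (B j p, 0))"
    by (simp only: linear_add[OF lin] linear_sum[OF lin] linear_scale[OF lin])
  then show ?thesis
    by (simp add: system_field_def heis_mult_deriv_linear_field[OF assms(1) M']
        heis_mult_deriv_right_invariant[OF M' assms(2)])
qed

lemma has_integral_Pair:
  fixes f :: "'c::euclidean_space \<Rightarrow> 'a::real_normed_vector" and g :: "'c \<Rightarrow> 'b::real_normed_vector"
  assumes "(f has_integral a) S" "(g has_integral b) S"
  shows "((\<lambda>s. (f s, g s)) has_integral (a, b)) S"
proof -
  have "bounded_linear (\<lambda>x::'a. (x, 0::'b))" "bounded_linear (\<lambda>y::'b. (0::'a, y))"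
    by (intro bounded_linear_Pair bounded_linear_ident bounded_linear_zero)+
  from has_integral_add[OF has_integral_linear[OF assms(1) this(1)] has_integral_linear[OF assms(2) this(2)]]
  show ?thesis by (simp add: o_def)
qed

section \<open>Two obstructions to controllability\<close>

text \<open>The chain rule is applied to the pair \<open>(\<gamma>, \<eta>)\<close> and to the defect \<open>W (p, q)\<close> of additivity of
  \<open>w\<close>, rather than to \<open>w\<close> and the product curve: this avoids integrating a product of
  Caratheodory curves. As \<open>m\<close> is additive, it cancels in the derivative of \<open>W\<close>, which is \<open>d W\<close>.\<close>

lemma reachable_from_one_additive:
  fixes \<X> :: "'n::finite heis \<Rightarrow> 'n heis" and B :: "'m::finite \<Rightarrow> 'n heis \<Rightarrow> 'n heis"
  assumes \<X>: "linear_field \<X>" and B: "\<And>j. B j \<in> heis_algebra"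
    and w: "C1 w" "w 0 = 0"
    and eqn: "satisfies_equation \<X> B w (\<lambda>g. d * w g + m g)"
    and m: "\<And>g h. m (heis_mult g h) = m g + m h"
    and traj: "admissible_input u" "trajectory \<X> B u T \<gamma>" "\<gamma> 0 = 0" "0 \<le> T"
  shows "w (heis_mult (\<gamma> T) g) = w (\<gamma> T) + w g"
proof -
  obtain \<phi> where \<phi>: "\<phi> 0 = id" "\<And>s t. \<phi> (s + t) = \<phi> s \<circ> \<phi> t"
    "\<And>g t. ((\<lambda>t. \<phi> t g) has_vector_derivative \<X> (\<phi> t g)) (at t)"
    using \<X> unfolding linear_field_def by blast
  have smooth: "smooth \<X>" "\<And>j. smooth (B j)" "\<And>j. right_invariant (B j)"
    using \<X> B by (auto simp: linear_field_def heis_algebra_def)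
  \<comment> \<open>The flow line through \<open>g\<close> at the final time \<open>T\<close>.\<close>
  define \<eta> where "\<eta> t = \<phi> t (\<phi> (- T) g)" for t
  have \<eta>T: "\<eta> T = g" using fun_cong[OF \<phi>(2)[of T "- T"], of g] by (simp add: \<eta>_def \<phi>(1))
  have \<eta>': "(\<eta> has_vector_derivative \<X> (\<eta> t)) (at t within S)" for t S
    unfolding \<eta>_def by (rule has_vector_derivative_at_within) (rule \<phi>(3))
  have \<eta>_cont: "continuous_on {0..T} \<eta>"
    using has_vector_derivative_continuous[OF \<eta>'] by (auto simp: continuous_on_eq_continuous_within)
  define F where "F s = system_field \<X> B (u s) (\<gamma> s)" for s
  have \<gamma>: "continuous_on {0..T} \<gamma>" "\<And>t. t \<in> {0..T} \<Longrightarrow> (F has_integral (\<gamma> t - \<gamma> 0)) {0..t}"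
    using traj(2) unfolding trajectory_def F_def by auto
  define W where "W k = w (heis_mult (fst k) (snd k)) - w (fst k) - w (snd k)" for k
  obtain w' where w': "\<And>p. (w has_derivative blinfun_apply (w' p)) (at p)"
    using w(1) unfolding C1_def by blast
  have w'_field: "w' p (system_field \<X> B v p) = d * w p + m p" for p v
    using eqn frechet_derivative_at[OF w'] unfolding satisfies_equation_def by metis
  have W: "C1 W" unfolding W_def
    by (intro C1_diff C1_compose[OF _ w(1)] C1_heis_mult C1_bounded_linear bounded_linear_fst bounded_linear_snd)
  then obtain W' where W': "\<And>k. (W has_derivative blinfun_apply (W' k)) (at k)" "continuous_on UNIV W'"
    unfolding C1_def by blast
  have W'_field: "W' (p, q) (system_field \<X> B v p, \<X> q) = d * W (p, q)" for p q v
  proof -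
    obtain M' where M': "((\<lambda>k. heis_mult (fst k) (snd k)) has_derivative M') (at (p, q))"
      using C1_heis_mult unfolding C1_def by blast
    have "(W has_derivative (\<lambda>v. w' (heis_mult p q) (M' v) - w' p (fst v) - w' q (snd v))) (at (p, q))"
      unfolding W_def
    proof (intro has_derivative_diff)
      show "((\<lambda>k. w (heis_mult (fst k) (snd k))) has_derivative (\<lambda>v. w' (heis_mult p q) (M' v))) (at (p, q))"
        by (rule has_derivative_compose[OF M']) (simp add: w')
      show "((\<lambda>k. w (fst k)) has_derivative (\<lambda>v. w' p (fst v))) (at (p, q))"
        by (rule has_derivative_compose[OF bounded_linear_imp_has_derivative[OF bounded_linear_fst]])
          (simp add: w')
      show "((\<lambda>k. w (snd k)) has_derivative (\<lambda>v. w' q (snd v))) (at (p, q))"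
        by (rule has_derivative_compose[OF bounded_linear_imp_has_derivative[OF bounded_linear_snd]])
          (simp add: w')
    qed
    from has_derivative_unique[OF W'(1) this]
    have "W' (p, q) (system_field \<X> B v p, \<X> q) = w' (heis_mult p q) (system_field \<X> B v (heis_mult p q))
        - w' p (system_field \<X> B v p) - w' q (system_field \<X> B 0 q)"
      by (simp add: heis_mult_deriv_system_field[OF \<X> smooth(3) M'])
    also have "\<dots> = d * W (p, q)" by (simp only: w'_field m) (simp add: W_def algebra_simps)
    finally show ?thesis .
  qed
  define \<delta> where "\<delta> t = W (\<gamma> t, \<eta> t)" for t
  have \<delta>': "(\<delta> has_real_derivative d * \<delta> t) (at t within {0..T})" if t: "t \<in> {0..T}" for t
    unfolding \<delta>_def
  proof (rule caratheodory_chain_rule[where F = "\<lambda>s. (F s, \<X> (\<eta> s))", OF _ _ _ W'])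
    fix s assume s: "s \<in> {0..T}"
    have "((\<lambda>s. \<X> (\<eta> s)) has_integral (\<eta> s - \<eta> 0)) {0..s}"
      using s \<eta>' by (intro fundamental_theorem_of_calculus) auto
    from has_integral_Pair[OF \<gamma>(2)[OF s] this]
    show "((\<lambda>s. (F s, \<X> (\<eta> s))) has_integral (\<gamma> s, \<eta> s) - (\<gamma> 0, \<eta> 0)) {0..s}" by simp
    show "W' (\<gamma> s, \<eta> s) (F s, \<X> (\<eta> s)) = d * W (\<gamma> s, \<eta> s)"
      unfolding F_def by (rule W'_field)
  next
    have "bounded (F ` {0..T})"
      unfolding F_def by (intro trajectory_field_bounded smooth_continuous smooth traj \<gamma>)
    moreover have "bounded ((\<lambda>s. \<X> (\<eta> s)) ` {0..T})"
      using continuous_on_compose2[OF smooth_continuous[OF smooth(1)] \<eta>_cont]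
      by (intro compact_imp_bounded compact_continuous_image) auto
    ultimately have "bounded (F ` {0..T} \<times> (\<lambda>s. \<X> (\<eta> s)) ` {0..T})" by (rule bounded_Times)
    then show "bounded ((\<lambda>s. (F s, \<X> (\<eta> s))) ` {0..T})" by (rule bounded_subset) auto
  next
    show pair: "continuous_on {0..T} (\<lambda>s. (\<gamma> s, \<eta> s))"
      by (intro continuous_intros \<gamma> \<eta>_cont)
    show "continuous_on {0..T} (\<lambda>s. d * W (\<gamma> s, \<eta> s))"
      by (intro continuous_intros continuous_on_compose2[OF C1_imp_continuous_on[OF W] pair]) auto
  qed (rule t)
  have "\<delta> 0 = 0" by (simp add: \<delta>_def W_def traj(3) w(2))
  moreover have "\<delta> T \<ge> exp (d * T) * \<delta> 0"
    by (rule differential_inequality[OF \<delta>' _ traj(4)]) auto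
  moreover have "- \<delta> T \<ge> exp (d * T) * - \<delta> 0"
    by (rule differential_inequality[of T "\<lambda>t. - \<delta> t" "\<lambda>t. - (d * \<delta> t)", OF DERIV_minus[OF \<delta>'] _ traj(4)])
      auto
  ultimately have "\<delta> T = 0" by simp
  then show ?thesis by (simp add: \<delta>_def W_def \<eta>T)
qed

text \<open>The quantity \<open>exp (- d t) (w - k)\<close> is nondecreasing along trajectories, whatever the sign of \<open>d\<close>.\<close>

lemma reachable_above:
  fixes \<X> :: "'n::finite heis \<Rightarrow> 'n heis" and B :: "'m::finite \<Rightarrow> 'n heis \<Rightarrow> 'n heis"
  assumes \<X>: "smooth \<X>" and B: "\<And>j. smooth (B j)"
    and w: "C1 w"
    and eqn: "satisfies_equation \<X> B w f" "continuous_on UNIV f" "\<And>g. f g \<ge> d * (w g - k)"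
    and traj: "admissible_input u" "trajectory \<X> B u T \<gamma>" "0 \<le> T"
    and start: "w (\<gamma> 0) > k"
  shows "w (\<gamma> T) > k"
proof -
  obtain w' where w': "\<And>p. (w has_derivative blinfun_apply (w' p)) (at p)" "continuous_on UNIV w'"
    using w unfolding C1_def by blast
  have w'_field: "w' p (system_field \<X> B v p) = f p" for p v
    using eqn(1) frechet_derivative_at[OF w'(1)] unfolding satisfies_equation_def by metis
  have \<gamma>: "continuous_on {0..T} \<gamma>" using traj(2) unfolding trajectory_def by blast
  have deriv: "((\<lambda>s. w (\<gamma> s) - k) has_real_derivative f (\<gamma> t)) (at t within {0..T})"
    if t: "t \<in> {0..T}" for t
  proof -
    have "((\<lambda>s. w (\<gamma> s)) has_real_derivative f (\<gamma> t)) (at t within {0..T})"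
    proof (rule caratheodory_chain_rule[OF _ _ \<gamma> w' _ w'_field t])
      show "((\<lambda>s. system_field \<X> B (u s) (\<gamma> s)) has_integral (\<gamma> s - \<gamma> 0)) {0..s}"
        if "s \<in> {0..T}" for s using traj(2) that unfolding trajectory_def by blast
      show "bounded ((\<lambda>s. system_field \<X> B (u s) (\<gamma> s)) ` {0..T})"
        by (intro trajectory_field_bounded smooth_continuous \<X> B traj \<gamma>)
      show "continuous_on {0..T} (\<lambda>s. f (\<gamma> s))"
        by (rule continuous_on_compose2[OF eqn(2) \<gamma>]) auto
    qed
    from DERIV_diff[OF this DERIV_const] show ?thesis by simp
  qed
  have "w (\<gamma> T) - k \<ge> exp (d * T) * (w (\<gamma> 0) - k)"
    by (rule differential_inequality[OF deriv eqn(3) traj(3)])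
  moreover have "exp (d * T) * (w (\<gamma> 0) - k) > 0" using start by simp
  ultimately show ?thesis by linarith
qed

section \<open>Coordinates associated with a symplectic basis\<close>

lemma symplectic_basis_in_algebra:
  assumes "symplectic_basis X Y Z"
  shows "X i \<in> heis_algebra" "Y i \<in> heis_algebra" "Z \<in> heis_algebra"
proof -
  let ?b = "case_sum X (case_sum Y (\<lambda>_::unit. Z))"
  have *: "?b a \<in> heis_algebra" for a
    using assms span_base[of "?b a" "range ?b"] unfolding symplectic_basis_def Let_def by auto
  show "X i \<in> heis_algebra" "Y i \<in> heis_algebra" "Z \<in> heis_algebra"
    using *[of "Inl i"] *[of "Inr (Inl i)"] *[of "Inr (Inr ())"] by simp_all
qed

text \<open>As a bracket \<open>[X i, Y i]\<close>, the field \<open>Z\<close> is vertical, and a vertical right-invariant field is constant.\<close>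

lemma symplectic_basis_center:
  fixes X Y :: "'n::finite \<Rightarrow> 'n heis \<Rightarrow> 'n heis"
  assumes "symplectic_basis X Y Z"
  obtains \<zeta> where "\<And>p. Z p = (0, 0, \<zeta>)"
proof
  fix p
  obtain i :: 'n where True by simp
  have "lie_bracket (X i) (Y i) = Z" using assms by (simp add: symplectic_basis_def)
  then have "fst (Z 0) = 0" "fst (snd (Z 0)) = 0"
    using lie_bracket_heis_algebra_vertical symplectic_basis_in_algebra[OF assms] by metis+
  moreover have "right_invariant Z"
    using symplectic_basis_in_algebra(3)[OF assms] by (simp add: heis_algebra_def)
  ultimately show "Z p = (0, 0, snd (snd (Z 0)))" using right_invariant_eq[of Z p] by simp
qed

lemma coordinates_derivative:
  assumes "associated_coordinates X Y Z \<Psi>"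
  obtains \<Psi>' where "\<And>p. (\<Psi> has_derivative \<Psi>' p) (at p)" "\<And>i p. \<Psi>' p (X i p) = std_X i (\<Psi> p)"
    "\<And>i p. \<Psi>' p (Y i p) = std_Y i (\<Psi> p)" "\<And>p. \<Psi>' p (Z p) = std_Z (\<Psi> p)"
proof
  have "smooth \<Psi>" using assms by (simp add: associated_coordinates_def)
  then show "(\<Psi> has_derivative frechet_derivative \<Psi> (at p)) (at p)" for p
    by cases (metis frechet_derivative_at)
qed (use assms in \<open>auto simp: associated_coordinates_def\<close>)

text \<open>The differential of \<open>\<pi>\<close> takes a constant value on each \<open>X i\<close>, \<open>Y i\<close> and \<open>Z\<close>, hence on each
  right-invariant field \<open>V\<close>. Right translation by \<open>h\<close> preserves \<open>V\<close>, so \<open>g \<mapsto> \<pi> (g h) - \<pi> g\<close> has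
  derivative zero along \<open>V\<close>. These fields span the tangent spaces, so the difference is constant,
  equal to its value \<open>\<pi> h\<close> at the identity.\<close>

lemma xy_part_mult:
  fixes X Y :: "'n::finite \<Rightarrow> 'n heis \<Rightarrow> 'n heis"
  assumes basis: "symplectic_basis X Y Z" and coord: "associated_coordinates X Y Z \<Psi>"
  shows "xy_part \<Psi> (heis_mult g h) = xy_part \<Psi> g + xy_part \<Psi> h"
proof -
  obtain \<Psi>' where \<Psi>': "\<And>p. (\<Psi> has_derivative \<Psi>' p) (at p)"
    and \<Psi>'X: "\<And>i p. \<Psi>' p (X i p) = std_X i (\<Psi> p)" and \<Psi>'Y: "\<And>i p. \<Psi>' p (Y i p) = std_Y i (\<Psi> p)"
    and \<Psi>'Z: "\<And>p. \<Psi>' p (Z p) = std_Z (\<Psi> p)"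
    using coordinates_derivative[OF coord] by metis
  define \<pi> where "\<pi> = xy_part \<Psi>"
  define \<pi>' where "\<pi>' p v = (fst (\<Psi>' p v), fst (snd (\<Psi>' p v)))" for p v
  have \<pi>_eq: "\<pi> = (\<lambda>p. (fst (\<Psi> p), fst (snd (\<Psi> p))))"
    by (auto simp: \<pi>_def xy_part_def fun_eq_iff split: prod.splits)
  have \<pi>': "(\<pi> has_derivative \<pi>' p) (at p)" for p
    unfolding \<pi>_eq \<pi>'_def by (intro derivative_intros \<Psi>')
  have lin: "linear (\<pi>' p)" for p using \<pi>' by (rule has_derivative_linear)
  let ?b = "case_sum X (case_sum Y (\<lambda>_::unit. Z))"
  have const: "\<exists>c. \<forall>p. \<pi>' p (V p) = c" if "V \<in> heis_algebra" for V
  proof -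
    have "V \<in> span (range ?b)" using basis that by (simp add: symplectic_basis_def Let_def)
    then show ?thesis
    proof (rule span_induct)
      show "subspace {V. \<exists>c. \<forall>p. \<pi>' p (V p) = c}"
      proof (rule subspaceI)
        show "0 \<in> {V. \<exists>c. \<forall>p. \<pi>' p (V p) = c}"
          by (intro CollectI exI[of _ 0]) (simp add: linear_0[OF lin])
        show "V + W \<in> {V. \<exists>c. \<forall>p. \<pi>' p (V p) = c}"
          if "V \<in> {V. \<exists>c. \<forall>p. \<pi>' p (V p) = c}" "W \<in> {V. \<exists>c. \<forall>p. \<pi>' p (V p) = c}" for V W
          using that by (auto simp: linear_add[OF lin])
        show "r *\<^sub>R V \<in> {V. \<exists>c. \<forall>p. \<pi>' p (V p) = c}"
          if "V \<in> {V. \<exists>c. \<forall>p. \<pi>' p (V p) = c}" for r V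
          using that by (auto simp: scaleR_fun_def linear_scale[OF lin])
      qed
      show "\<exists>c. \<forall>p. \<pi>' p (V p) = c" if "V \<in> range ?b" for V
        using that by (auto simp: \<pi>'_def \<Psi>'X \<Psi>'Y \<Psi>'Z std_X_def std_Y_def std_Z_def
            split: sum.splits prod.splits)
    qed
  qed
  define \<rho> where "\<rho> g = \<pi> (heis_mult g h) - \<pi> g" for g
  have \<rho>': "(\<rho> has_derivative (\<lambda>_. 0)) (at p)" for p
  proof -
    let ?R = "frechet_derivative (\<lambda>k. heis_mult k h) (at p)"
    have R: "((\<lambda>k. heis_mult k h) has_derivative ?R) (at p)"
      unfolding frechet_derivative_at[OF has_derivative_right_translation, symmetric]
      by (rule has_derivative_right_translation)
    have "(\<rho> has_derivative (\<lambda>v. \<pi>' (heis_mult p h) (?R v) - \<pi>' p v)) (at p)"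
      unfolding \<rho>_def by (intro has_derivative_diff \<pi>' has_derivative_compose[OF R \<pi>'])
    moreover have "\<pi>' (heis_mult p h) (?R v) - \<pi>' p v = 0" for v
    proof -
      obtain V where V: "V \<in> heis_algebra" "V p = v" by (rule heis_algebra_value)
      then have "?R v = V (heis_mult p h)" unfolding heis_algebra_def right_invariant_def by blast
      moreover obtain c where "\<And>q. \<pi>' q (V q) = c" using const[OF V(1)] by metis
      ultimately show ?thesis using V(2) by (metis diff_self)
    qed
    ultimately show ?thesis by simp
  qed
  have "\<exists>c. \<forall>p\<in>UNIV. \<rho> p = c"
    by (rule has_derivative_zero_constant[OF convex_UNIV \<rho>'])
  then obtain c where c: "\<And>p. \<rho> p = c" by (metis UNIV_I)
  have "\<pi> 0 = 0" using coord by (simp add: \<pi>_eq associated_coordinates_def zero_prod_def)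
  then have "\<rho> 0 = \<pi> h" by (simp add: \<rho>_def)
  then have "\<rho> g = \<pi> h" using c by metis
  then show ?thesis by (simp add: \<rho>_def \<pi>_def algebra_simps)
qed

text \<open>The curve \<open>t \<mapsto> \<Psi> (t *\<^sub>R z)\<close> has constant velocity \<open>(0, 0, 1)\<close> and starts at the origin.\<close>

lemma coordinates_central:
  fixes X Y :: "'n::finite \<Rightarrow> 'n heis \<Rightarrow> 'n heis"
  assumes coord: "associated_coordinates X Y Z \<Psi>" and Z: "\<And>p. Z p = z"
  shows "\<Psi> z = (0, 0, 1)"
proof -
  obtain \<Psi>' where \<Psi>': "\<And>p. (\<Psi> has_derivative \<Psi>' p) (at p)"
    and \<Psi>'Z: "\<And>p. \<Psi>' p (Z p) = std_Z (\<Psi> p)"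
    using coordinates_derivative[OF coord] by metis
  have \<Psi>'z: "\<Psi>' p (t *\<^sub>R z) = (0, 0, t)" for p t
    using \<Psi>'Z[of p] linear_scale[OF has_derivative_linear[OF \<Psi>'], of p t z]
    by (simp add: Z std_Z_def split: prod.splits)
  have line: "((\<lambda>t. t *\<^sub>R z) has_derivative (\<lambda>t. t *\<^sub>R z)) (at t)" for t :: real
    by (auto intro!: derivative_eq_intros)
  have vert: "((\<lambda>t. (0, 0, t)) has_derivative (\<lambda>t. (0, 0, t))) (at t)" for t :: real
    by (auto intro!: derivative_eq_intros)
  have "((\<lambda>t. \<Psi> (t *\<^sub>R z) - (0, 0, t)) has_derivative (\<lambda>_. 0)) (at t)" for t :: real
    using has_derivative_diff[OF has_derivative_compose[OF line \<Psi>'] vert]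
    by (simp add: \<Psi>'z zero_prod_def)
  then obtain c where c: "\<And>t::real. \<Psi> (t *\<^sub>R z) - (0, 0, t) = c"
    using has_derivative_zero_constant[of UNIV "\<lambda>t. \<Psi> (t *\<^sub>R z) - (0, 0, t)"] by auto
  have "\<Psi> 0 = 0" using coord by (simp add: associated_coordinates_def)
  then show ?thesis using c[of 0] c[of 1] by (simp add: zero_prod_def[symmetric])
qed

lemma C1_changed_variable:
  fixes \<Psi> :: "'n::finite heis \<Rightarrow> (real^'n) \<times> (real^'n) \<times> real"
  assumes "smooth \<Psi>" "admissible_polynomial P"
  shows "C1 (changed_variable \<Psi> P)"
proof -
  obtain l q where l: "linear l" "quadratic_form q" "P = (\<lambda>v. l v + q v)"
    using assms(2) unfolding admissible_polynomial_def fun_eq_iff by blast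
  obtain \<beta> where \<beta>: "bilinear \<beta>" "q = (\<lambda>v. \<beta> v v)"
    using l(2) unfolding quadratic_form_def fun_eq_iff by blast
  have "C1 l" using l(1) by (intro C1_bounded_linear) (simp add: linear_conv_bounded_linear)
  moreover have "C1 (\<lambda>v. \<beta> v v)"
    using C1_bilinear[OF _ C1_bounded_linear[OF bounded_linear_ident] C1_bounded_linear[OF bounded_linear_ident]]
      \<beta>(1) by (simp add: bilinear_conv_bounded_bilinear)
  ultimately have P: "C1 P" unfolding l(3) \<beta>(2) by (rule C1_add)
  have "C1 (\<lambda>p::(real^'n) \<times> (real^'n) \<times> real. (fst p, fst (snd p)))"
    by (intro C1_bounded_linear bounded_linear_Pair bounded_linear_fst
        bounded_linear_compose[OF bounded_linear_fst bounded_linear_snd])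
  then have "C1 (\<lambda>p::(real^'n) \<times> (real^'n) \<times> real. P (fst p, fst (snd p)))" using P by (rule C1_compose)
  from C1_add[OF C1_bounded_linear[OF bounded_linear_compose[OF bounded_linear_snd bounded_linear_snd]] this]
  have "C1 (\<lambda>p. snd (snd p) + P (fst p, fst (snd p)))" .
  from C1_compose[OF smooth_C1[OF assms(1)] this] show ?thesis
    by (simp add: changed_variable_def[abs_def] z_part_def xy_part_def case_prod_unfold)
qed

text \<open>The elements \<open>(0, y, 0)\<close> and \<open>(x, 0, 0)\<close> have products \<open>(x, y, y \<bullet> x)\<close> and \<open>(x, y, 0)\<close> in the two
  orders, so \<open>(0, 0, y \<bullet> x)\<close> is a commutator.\<close>

lemma additive_vanishes_on_center:
  fixes w :: "'n::finite heis \<Rightarrow> real"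
  assumes "\<And>g h. w (heis_mult g h) = w g + w h"
  shows "w (0, 0, s) = 0"
proof -
  obtain i :: 'n where True by simp
  define x y where "x = axis i s" and "y = (axis i 1 :: real^'n)"
  have "y \<bullet> x = s" by (simp add: x_def y_def inner_axis_axis)
  then have "w (0, y, 0) + w (x, 0, 0) = w (x, y, s)"
    by (simp add: assms[symmetric] heis_mult_eq)
  also have "\<dots> = w (x, y, 0) + w (0, 0, s)"
    by (simp add: assms[symmetric] heis_mult_eq)
  also have "w (x, y, 0) = w (x, 0, 0) + w (0, y, 0)"
    by (simp add: assms[symmetric] heis_mult_eq)
  finally show ?thesis by simp
qed

section \<open>Failure of controllability\<close>

theorem theorem5:
  fixes \<X> :: "'n::finite heis \<Rightarrow> 'n heis"
    and B :: "'m::finite \<Rightarrow> 'n heis \<Rightarrow> 'n heis"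
    and X Y :: "'n \<Rightarrow> 'n heis \<Rightarrow> 'n heis"
    and Z :: "'n heis \<Rightarrow> 'n heis"
    and d :: real
    and \<Psi> :: "'n heis \<Rightarrow> (real^'n) \<times> (real^'n) \<times> real"
    and P l' Q' :: "(real^'n) \<times> (real^'n) \<Rightarrow> real"
  assumes linear_field: "linear_field \<X>"
    and B_in_algebra: "\<And>j. B j \<in> heis_algebra"
    and Z_generator: "span {Z} = heis_center"
    and d_eigenvalue: "derivation_of \<X> Z = d *\<^sub>R Z"
    and Z_not_generated: "Z \<notin> lie_generated (range B)"
    and d_nonzero: "d \<noteq> 0"
    and basis: "symplectic_basis X Y Z"
    and B_in_span: "\<And>j. B j \<in> span (range X \<union> range Y)"
    and coordinates: "associated_coordinates X Y Z \<Psi>"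
    and admissible: "admissible_polynomial P"
    and linear_l': "linear l'"
    and quadratic_Q': "quadratic_form Q'"
    and w_equation: "satisfies_equation \<X> B (changed_variable \<Psi> P)
          (\<lambda>g. d * changed_variable \<Psi> P g + l' (xy_part \<Psi> g) + Q' (xy_part \<Psi> g))"
    and Q'_nonneg: "\<And>v. Q' v \<ge> 0"
    and kernels: "{v. l' v = 0} \<subseteq> quadratic_kernel Q'"
  shows "\<not> controllable \<X> B"
proof
  assume ctrl: "controllable \<X> B"
  define w where "w = changed_variable \<Psi> P"
  have smooth: "smooth \<X>" "\<And>j. smooth (B j)" "smooth \<Psi>"
    using linear_field B_in_algebra coordinates
    by (auto simp: linear_field_def heis_algebra_def associated_coordinates_def)
  have w_C1: "C1 w" unfolding w_def using smooth(3) admissible by (rule C1_changed_variable)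
  have P0: "P 0 = 0"
    using admissible linear_0 bilinear_lzero
    unfolding admissible_polynomial_def quadratic_form_def by (metis add_0)
  have \<Psi>: "bij \<Psi>" "\<Psi> 0 = 0" using coordinates by (auto simp: associated_coordinates_def)
  have w_vertical: "w p = s" if "\<Psi> p = (0, 0, s)" for p s
    using P0 that by (simp add: w_def changed_variable_def z_part_def xy_part_def zero_prod_def)
  obtain c where c: "c \<ge> 0" "\<And>v. Q' v = c * (l' v)\<^sup>2"
    using quadratic_form_eq_square[OF linear_l' quadratic_Q' Q'_nonneg kernels] by blast
  define m where "m g = l' (xy_part \<Psi> g)" for g
  have w_eqn: "satisfies_equation \<X> B w (\<lambda>g. d * w g + m g + c * (m g)\<^sup>2)"
    using w_equation by (simp add: w_def m_def c(2))
  show False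
  proof (cases "c = 0")
    case True
    have m_mult: "m (heis_mult g h) = m g + m h" for g h
      by (simp add: m_def xy_part_mult[OF basis coordinates] linear_add[OF linear_l'])
    have w0: "w 0 = 0" using w_vertical[of 0 0] \<Psi>(2) by (simp add: zero_prod_def)
    have "w (heis_mult h g) = w h + w g" for g h
    proof -
      obtain T u \<gamma> where \<gamma>: "0 \<le> T" "admissible_input u" "trajectory \<X> B u T \<gamma>" "\<gamma> 0 = 0" "\<gamma> T = h"
        using ctrl unfolding controllable_def by metis
      show ?thesis
        using reachable_from_one_additive[OF linear_field B_in_algebra w_C1 w0 _ m_mult \<gamma>(2,3,4,1)]
          w_eqn True \<gamma>(5) by simp
    qed
    then have "w (0, 0, s) = 0" for s by (rule additive_vanishes_on_center)
    moreover obtain \<zeta> where \<zeta>: "\<And>p. Z p = (0, 0, \<zeta>)" using symplectic_basis_center[OF basis] by metis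
    moreover have "w (0, 0, \<zeta>) = 1"
      using w_vertical coordinates_central[OF coordinates \<zeta>] by simp
    ultimately show False by simp
  next
    case False
    \<comment> \<open>The value of \<open>w\<close> at which the lower bound \<open>d w - 1 / (4 c)\<close> of \<open>w'\<close> vanishes.\<close>
    define k where "k = 1 / (4 * c * d)"
    have square: "d * w g + m g + c * (m g)\<^sup>2 \<ge> d * (w g - k)" for g
    proof -
      have "c * (m g + 1 / (2 * c))\<^sup>2 \<ge> 0" using c(1) by simp
      moreover have "c * (m g + 1 / (2 * c))\<^sup>2 = c * (m g)\<^sup>2 + m g + 1 / (4 * c)"
      proof -
        have "2 * (m g * (1 / (2 * c))) * c = m g" "c * (1 / (2 * c))\<^sup>2 = 1 / (4 * c)"
          using False by (simp_all add: power2_eq_square)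
        then show ?thesis by (simp add: power2_sum distrib_left mult_ac)
      qed
      moreover have "d * (w g - k) = d * w g - 1 / (4 * c)"
        using d_nonzero False by (simp add: k_def right_diff_distrib)
      ultimately show ?thesis by simp
    qed
    have w_cont: "continuous_on UNIV w"
      using w_C1 by (rule C1_imp_continuous_on)
    have "continuous_on UNIV m"
    proof -
      have "continuous_on UNIV (\<lambda>g. (fst (\<Psi> g), fst (snd (\<Psi> g))))"
        by (intro continuous_intros smooth_continuous smooth)
      from continuous_on_compose2[OF linear_continuous_on[OF linear_l'[unfolded linear_conv_bounded_linear]] this subset_UNIV]
      show ?thesis by (simp add: m_def[abs_def] xy_part_def case_prod_unfold)
    qed
    then have f_cont: "continuous_on UNIV (\<lambda>g. d * w g + m g + c * (m g)\<^sup>2)"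
      by (intro continuous_intros w_cont)
    have w_inv: "w (inv_into UNIV \<Psi> (0, 0, s)) = s" for s
      using \<Psi>(1) by (intro w_vertical) (simp add: bij_is_surj surj_f_inv_f)
    obtain T u \<gamma> where \<gamma>: "0 \<le> T" "admissible_input u" "trajectory \<X> B u T \<gamma>"
      "\<gamma> 0 = inv_into UNIV \<Psi> (0, 0, k + 1)" "\<gamma> T = inv_into UNIV \<Psi> (0, 0, k)"
      using ctrl unfolding controllable_def by metis
    have "w (\<gamma> T) > k"
      using reachable_above[OF smooth(1,2) w_C1 w_eqn f_cont square \<gamma>(2,3,1)] by (simp add: \<gamma>(4) w_inv)
    then show False by (simp add: \<gamma>(5) w_inv)
  qed
qed

end
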